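(* Let $p\in[1,\infty]$. For all $x,y\in\mathbb{R}^{1,1}$ with $x\gg 0$ and $y\gg 0$, the reverse triangle inequality $$|x+y|^p\ \ge\ |x|^p+|y|^p$$ holds (here $|\cdot|^p$ denotes the function defined in the context, not a $p$-th power). Thereby, $(\mathbb{R}^{1,1},\tau^p)$ is an almost Lorentzian pre-length space.
   Context: $\mathbb{R}^{1,1}$ is $\mathbb{R}^2$ with coordinates $x=(x_0,x_1)$ and the Minkowski relations: $x\ll y$ iff $y_0-x_0>|y_1-x_1|$, and $x\le y$ iff $y_0-x_0\ge|y_1-x_1|$; $x\gg0$ means $0\ll x$. For $1\le p<\infty$ the superscript $p$ in $|x|^p$ is a label: $|x|^p:=(|x_0|^p-|x_1|^p)^{1/p}$ (with ordinary powers on the right) if $|x_0|\ge|x_1|$ and $x_0>0$, and $|x|^p:=0$ otherwise. For $p=\infty$, $|x|^\infty$ is the pointwise limit as $p\to\infty$: $|x|^\infty=x_0$ if $x_0>|x_1|$ and $|x|^\infty=0$ otherwise. The time separation function is $\tau^p(x,y):=|y-x|^p$. An almost Lorentzian pre-length space is a pair $(X,\tau)$ of a set $X$ and an antisymmetric function $\tau:X\times X\to\mathbb{R}$ such that $\tau(x,z)\ge\tau(x,y)+\tau(y,z)$ for all $x,y,z\in X$ with $\tau(x,y)>0$ and $\tau(y,z)>0$. By convention, a non-negative time separation function $\tau$ is identified with its antisymmetric version $\tau^a(x,y)=\tau(x,y)-\tau(y,x)$; the second assertion is about this antisymmetric version of $\tau^p$. *)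

theory Defs
  imports "HOL-Analysis.Analysis"
begin

text \<open>A point \<open>x = (x\<^sub>0, x\<^sub>1)\<close> of two-dimensional Minkowski space has time coordinate \<open>fst x\<close>
  and space coordinate \<open>snd x\<close>.\<close>

type_synonym minkowski = "real \<times> real"

definition chron :: "minkowski \<Rightarrow> minkowski \<Rightarrow> bool" (infix "\<lless>" 50) where
  "x \<lless> y \<longleftrightarrow> fst y - fst x > \<bar>snd y - snd x\<bar>"

definition lor_fin :: "real \<Rightarrow> minkowski \<Rightarrow> real" where
  "lor_fin r x =
     (if \<bar>fst x\<bar> \<ge> \<bar>snd x\<bar> \<and> fst x > 0
      then (\<bar>fst x\<bar> powr r - \<bar>snd x\<bar> powr r) powr (1 / r) else 0)"

definition lor_inf :: "minkowski \<Rightarrow> real" where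
  "lor_inf x = (if fst x > \<bar>snd x\<bar> then fst x else 0)"

text \<open>The function written \<open>|x|\<^sup>p\<close> in the literature, where \<open>p\<close> is a label and not an exponent;
  it is only meaningful for \<open>1 \<le> p \<le> \<infinity>\<close>.\<close>

definition lor :: "ereal \<Rightarrow> minkowski \<Rightarrow> real" where
  "lor p x = (if p = \<infinity> then lor_inf x else lor_fin (real_of_ereal p) x)"

lemma lor_inf_pointwise_limit: "((\<lambda>r. lor_fin r x) \<longlongrightarrow> lor_inf x) at_top"
proof (cases "fst x > \<bar>snd x\<bar>")
  case True
  define a b where "a = fst x" and "b = \<bar>snd x\<bar>"
  have ab: "0 \<le> b" "b < a" using True by (auto simp: a_def b_def)
  define q where "q = b / a"
  have q: "0 \<le> q" "q < 1" using ab by (auto simp: q_def)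
  have q0: "((\<lambda>r. q powr r) \<longlongrightarrow> 0) at_top"
  proof (cases "q = 0")
    case False
    then have "ln q < 0" using q by simp
    then have "filterlim (\<lambda>r. ln q * r) at_bot at_top"
      by (simp add: filterlim_tendsto_neg_mult_at_bot[OF tendsto_const] filterlim_ident)
    then have "((\<lambda>r. exp (ln q * r)) \<longlongrightarrow> 0) at_top"
      by (rule filterlim_compose[OF exp_at_bot])
    then show ?thesis using False by (simp add: powr_def mult.commute)
  qed simp
  have inv0: "((\<lambda>r::real. 1 / r) \<longlongrightarrow> 0) at_top"
    using tendsto_inverse_0_at_top[OF filterlim_ident] by (simp add: inverse_eq_divide)
  have "((\<lambda>r. a * (1 - q powr r) powr (1 / r)) \<longlongrightarrow> a * (1 - 0) powr 0) at_top"
    by (intro tendsto_intros q0 inv0) auto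
  then have lim: "((\<lambda>r. a * (1 - q powr r) powr (1 / r)) \<longlongrightarrow> a) at_top" by simp
  have "((\<lambda>r. (a powr r - b powr r) powr (1 / r)) \<longlongrightarrow> a) at_top"
  proof (rule Lim_transform_eventually[OF lim])
    show "\<forall>\<^sub>F r in at_top. a * (1 - q powr r) powr (1 / r) = (a powr r - b powr r) powr (1 / r)"
      using eventually_gt_at_top[of "0::real"]
    proof eventually_elim
      case (elim r)
      have "b = a * q" using ab by (simp add: q_def)
      then have "a powr r - b powr r = a powr r * (1 - q powr r)"
        using ab q by (simp add: powr_mult algebra_simps)
      moreover have "q powr r \<le> 1" using q elim by (simp add: powr_le1)
      ultimately show ?case using ab elim by (simp add: powr_mult powr_powr)
    qed
  qed
  moreover have "lor_fin r x = (a powr r - b powr r) powr (1 / r)" for r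
    using ab unfolding lor_fin_def a_def b_def by auto
  ultimately show ?thesis using True by (simp add: lor_inf_def a_def)
next
  case False
  then have "lor_fin r x = 0" for r
    by (auto simp: lor_fin_def)
  then show ?thesis using False by (simp add: lor_inf_def)
qed

definition time_sep :: "ereal \<Rightarrow> minkowski \<Rightarrow> minkowski \<Rightarrow> real" where
  "time_sep p x y = lor p (y - x)"

definition antisym_version :: "('a \<Rightarrow> 'a \<Rightarrow> real) \<Rightarrow> 'a \<Rightarrow> 'a \<Rightarrow> real" where
  "antisym_version \<tau> x y = \<tau> x y - \<tau> y x"

definition almost_lorentzian_pre_length_space :: "'a set \<Rightarrow> ('a \<Rightarrow> 'a \<Rightarrow> real) \<Rightarrow> bool" where
  "almost_lorentzian_pre_length_space X \<tau> \<longleftrightarrow>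
     (\<forall>x\<in>X. \<forall>y\<in>X. \<tau> x y = - \<tau> y x) \<and>
     (\<forall>x\<in>X. \<forall>y\<in>X. \<forall>z\<in>X. \<tau> x y > 0 \<and> \<tau> y z > 0 \<longrightarrow> \<tau> x z \<ge> \<tau> x y + \<tau> y z)"

end

theory Submission
  imports Defs
begin

text \<open>
  For a finite exponent \<open>r\<close>, the reverse triangle inequality is the ordinary triangle inequality of
  the \<open>\<ell>\<^sup>r\<close> plane read backwards. If \<open>u\<close> is the Lorentzian length of a future-directed vector with
  time component \<open>a\<close> and space component of modulus \<open>b\<close>, then \<open>u\<^sup>r + b\<^sup>r = a\<^sup>r\<close>: the time
  component is the \<open>\<ell>\<^sup>r\<close> norm of \<open>(u, b)\<close>. For a second vector, with data \<open>(v, d)\<close> and \<open>c\<close>,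
  Minkowski's inequality (\<open>powr_triangle_plane\<close>, a consequence of the convexity of \<open>s \<mapsto> s\<^sup>r\<close>) gives
  \<open>(u + v)\<^sup>r + (b + d)\<^sup>r \<le> (a + c)\<^sup>r\<close>; since the space component of the sum has modulus at most
  \<open>b + d\<close>, the length of the sum is at least \<open>u + v\<close>. For \<open>p = \<infinity>\<close> the length of a timelike
  vector is its time component, so the inequality is an equality.

  The second assertion follows because \<open>lor p\<close> is positive precisely on the open future cone
  (\<open>lor_pos_iff\<close>). Both \<open>v\<close> and \<open>-v\<close> cannot lie in this cone, so a positive antisymmetrized time
  separation comes from a chronologically related pair. The cone is closed under addition, and on
  it the antisymmetrization subtracts nothing, so the first assertion applies to the two
  displacement vectors.
\<close>

section \<open>The triangle inequality of the plane with exponent at least one\<close>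

lemma powr_convex_nonneg:
  fixes r :: real
  assumes "1 \<le> r"
  shows "convex_on {0..} (\<lambda>x. x powr r)"
proof (rule convex_on_linorderI)
  fix t x y :: real
  assume t: "0 < t" "t < 1" and xy: "x \<in> {0..}" "y \<in> {0..}" "x < y"
  show "((1 - t) *\<^sub>R x + t *\<^sub>R y) powr r \<le> (1 - t) * x powr r + t * y powr r"
  proof (cases "x = 0")
    \<comment> \<open>At the endpoint, convexity reduces to \<open>t\<^sup>r \<le> t\<close> on the unit interval.\<close>
    case True
    have "t powr r \<le> t powr 1"
      using t assms by (intro powr_mono') auto
    then have "t powr r * y powr r \<le> t * y powr r"
      using t by (intro mult_right_mono) auto
    then show ?thesis
      using True t xy by (simp add: powr_mult)
  next
    case False
    then show ?thesis
      using convex_onD[OF powr_convex[OF assms], of t x y] t xy by simp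
  qed
qed simp

text \<open>Minkowski's inequality for the vectors \<open>(u, b)\<close> and \<open>(v, d)\<close>, whose norms are at most \<open>a\<close>
  and \<open>c\<close>. In each coordinate, the sum divided by \<open>a + c\<close> is the convex combination of the
  first vector divided by \<open>a\<close> and the second divided by \<open>c\<close>, with weights \<open>a / (a + c)\<close> and \<open>c / (a + c)\<close>. Convexity bounds its \<open>r\<close>-th
  power, and the bounds for the two coordinates add up to at most one.\<close>

lemma powr_triangle_plane:
  fixes r a b c d u v :: real
  assumes r: "1 \<le> r" and pos: "0 < a" "0 < c"
    and nonneg: "0 \<le> u" "0 \<le> b" "0 \<le> v" "0 \<le> d"
    and norm_a: "u powr r + b powr r \<le> a powr r"
    and norm_c: "v powr r + d powr r \<le> c powr r"
  shows "(u + v) powr r + (b + d) powr r \<le> (a + c) powr r"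
proof -
  define w where "w = c / (a + c)"
  have w: "0 \<le> w" "w \<le> 1" using pos by (auto simp: w_def)
  have coord: "((s + t) / (a + c)) powr r \<le> (1 - w) * (s / a) powr r + w * (t / c) powr r"
    if "0 \<le> s" "0 \<le> t" for s t
  proof -
    have "1 - w = a / (a + c)" using pos by (simp add: w_def field_simps)
    then have "(1 - w) * (s / a) + w * (t / c) = (s + t) / (a + c)"
      using pos by (simp add: w_def add_divide_distrib)
    then show ?thesis
      using convex_onD[OF powr_convex_nonneg[OF r], of w "s / a" "t / c"] w pos that by simp
  qed
  have unit_a: "(u / a) powr r + (b / a) powr r \<le> 1"
    using norm_a nonneg pos by (simp add: powr_divide flip: add_divide_distrib)
  have unit_c: "(v / c) powr r + (d / c) powr r \<le> 1"
    using norm_c nonneg pos by (simp add: powr_divide flip: add_divide_distrib)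
  have "((u + v) / (a + c)) powr r + ((b + d) / (a + c)) powr r
      \<le> (1 - w) * ((u / a) powr r + (b / a) powr r) + w * ((v / c) powr r + (d / c) powr r)"
    using coord[of u v] coord[of b d] nonneg by (simp add: algebra_simps)
  also have "\<dots> \<le> (1 - w) * 1 + w * 1"
    using unit_a unit_c w by (intro add_mono mult_left_mono) auto
  finally show ?thesis
    using nonneg pos by (simp add: powr_divide flip: add_divide_distrib)
qed

section \<open>The reverse triangle inequality\<close>

text \<open>The time component is the \<open>\<ell>\<^sup>r\<close> norm of the pair formed by the Lorentzian length and the
  space component. The identity extends to null vectors, whose length is zero.\<close>

lemma lor_fin_powr_add:
  assumes "1 \<le> r" "\<bar>snd x\<bar> \<le> fst x" "0 < fst x"
  shows "lor_fin r x powr r + \<bar>snd x\<bar> powr r = fst x powr r"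
proof -
  have "\<bar>snd x\<bar> powr r \<le> fst x powr r"
    using assms by (intro powr_mono2) auto
  then show ?thesis
    using assms by (simp add: lor_fin_def powr_powr)
qed

lemma lor_fin_superadditive:
  assumes r: "1 \<le> r"
    and x: "\<bar>snd x\<bar> \<le> fst x" "0 < fst x" and y: "\<bar>snd y\<bar> \<le> fst y" "0 < fst y"
  shows "lor_fin r x + lor_fin r y \<le> lor_fin r (x + y)"
proof -
  let ?l = "lor_fin r x + lor_fin r y"
  have nonneg: "0 \<le> lor_fin r z" for z by (simp add: lor_fin_def)
  have "\<bar>snd (x + y)\<bar> powr r \<le> (\<bar>snd x\<bar> + \<bar>snd y\<bar>) powr r"
    using r by (intro powr_mono2) auto
  moreover have "?l powr r + (\<bar>snd x\<bar> + \<bar>snd y\<bar>) powr r \<le> (fst x + fst y) powr r"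
    using lor_fin_powr_add[OF r x] lor_fin_powr_add[OF r y] nonneg x y r
    by (intro powr_triangle_plane) auto
  ultimately have "?l powr r \<le> fst (x + y) powr r - \<bar>snd (x + y)\<bar> powr r"
    by simp
  then have "(?l powr r) powr (1 / r)
      \<le> (fst (x + y) powr r - \<bar>snd (x + y)\<bar> powr r) powr (1 / r)"
    using r by (intro powr_mono2) auto
  moreover have "(?l powr r) powr (1 / r) = ?l"
    using r nonneg[of x] nonneg[of y] by (simp add: powr_powr)
  moreover have "lor_fin r (x + y)
      = (fst (x + y) powr r - \<bar>snd (x + y)\<bar> powr r) powr (1 / r)"
    using x y by (auto simp: lor_fin_def)
  ultimately show ?thesis by simp
qed

lemma real_of_ereal_ge_1:
  fixes p :: ereal
  assumes "1 \<le> p" "p \<noteq> \<infinity>"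
  shows "1 \<le> real_of_ereal p"
  using assms by (cases p) (auto simp: one_ereal_def)

lemma lor_superadditive:
  assumes p: "1 \<le> p" and x: "0 \<lless> x" and y: "0 \<lless> y"
  shows "lor p x + lor p y \<le> lor p (x + y)"
proof (cases "p = \<infinity>")
  case True
  then show ?thesis
    using x y by (auto simp: lor_def lor_inf_def chron_def)
next
  case False
  then show ?thesis
    using lor_fin_superadditive[OF real_of_ereal_ge_1[OF p False], of x y] x y
    by (auto simp: lor_def chron_def)
qed

section \<open>Antisymmetrized time separation\<close>

text \<open>Null vectors are the only boundary case: for a finite exponent the two powers in their length
  cancel, and for \<open>p = \<infinity>\<close> the strict inequality in \<open>lor_inf\<close> excludes them.\<close>

lemma lor_pos_iff:
  assumes p: "1 \<le> p"
  shows "0 < lor p x \<longleftrightarrow> 0 \<lless> x"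
proof (cases "p = \<infinity>")
  case True
  then show ?thesis by (auto simp: lor_def lor_inf_def chron_def)
next
  case False
  define r where "r = real_of_ereal p"
  have r: "1 \<le> r" using real_of_ereal_ge_1[OF p False] by (simp add: r_def)
  have "\<bar>snd x\<bar> powr r < fst x powr r" if "\<bar>snd x\<bar> < fst x"
    using r that by (intro powr_less_mono2) auto
  then show ?thesis
    using False by (cases "\<bar>snd x\<bar> = fst x") (auto simp: lor_def lor_fin_def chron_def r_def)
qed

lemma lor_nonneg: "0 \<le> lor p x"
  by (auto simp: lor_def lor_fin_def lor_inf_def)

lemma antisym_time_sep_chron:
  assumes p: "1 \<le> p" and "0 \<lless> y - x"
  shows "antisym_version (time_sep p) x y = lor p (y - x)"
proof -
  have "\<not> 0 \<lless> x - y" using assms(2) by (auto simp: chron_def)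
  then have "lor p (x - y) = 0"
    using lor_pos_iff[OF p, of "x - y"] lor_nonneg[of p "x - y"] by linarith
  then show ?thesis by (simp add: antisym_version_def time_sep_def)
qed

lemma antisym_time_sep_pos_imp_chron:
  assumes p: "1 \<le> p" and "0 < antisym_version (time_sep p) x y"
  shows "0 \<lless> y - x"
proof -
  have "0 < lor p (y - x)"
    using assms(2) lor_nonneg[of p "x - y"] by (simp add: antisym_version_def time_sep_def)
  then show ?thesis using lor_pos_iff[OF p] by blast
qed

lemma chron_0_add: "0 \<lless> x \<Longrightarrow> 0 \<lless> y \<Longrightarrow> 0 \<lless> x + y"
  by (auto simp: chron_def)

theorem lemma3p2:
  fixes p :: ereal
  assumes "1 \<le> p"
  shows "(\<forall>x y :: minkowski. 0 \<lless> x \<and> 0 \<lless> y \<longrightarrow> lor p (x + y) \<ge> lor p x + lor p y) \<and>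
    almost_lorentzian_pre_length_space (UNIV :: minkowski set) (antisym_version (time_sep p))"
proof -
  let ?\<tau> = "antisym_version (time_sep p)"
  have "?\<tau> x y + ?\<tau> y z \<le> ?\<tau> x z" if "0 < ?\<tau> x y" "0 < ?\<tau> y z" for x y z
  proof -
    have xy: "0 \<lless> y - x" and yz: "0 \<lless> z - y"
      using that antisym_time_sep_pos_imp_chron[OF assms] by blast+
    have split: "z - x = (y - x) + (z - y)" by simp
    have "0 \<lless> z - x" unfolding split by (rule chron_0_add[OF xy yz])
    moreover have "lor p (y - x) + lor p (z - y) \<le> lor p (z - x)"
      unfolding split by (rule lor_superadditive[OF assms xy yz])
    ultimately show ?thesis
      using xy yz by (simp add: antisym_time_sep_chron[OF assms])
  qed
  moreover have "?\<tau> x y = - ?\<tau> y x" for x y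
    by (simp add: antisym_version_def)
  ultimately show ?thesis
    using lor_superadditive[OF assms]
    unfolding almost_lorentzian_pre_length_space_def by blast
qed

end
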